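(* Let $k\ge 1$. The poset $\mathbf{B}_{k+1}-\{[k+1]\}$ (the Boolean lattice $\mathbf{B}_{k+1}$ with its top element $[k+1]$ removed, with the induced inclusion order) is the unique minimal $(\mathbf{V}_{1,1};k)$-Ramsey poset.
   Context: The Boolean lattice $\mathbf{B}_N$ is the poset $(2^{[N]},\subseteq)$ of all subsets of $[N]=\{1,\dots,N\}$ ordered by inclusion. A poset $\mathbf{Q}$ contains a poset $\mathbf{P}$ as a subposet if there is an injection $\phi$ from the elements of $\mathbf{P}$ to those of $\mathbf{Q}$ with $x\le_{\mathbf{P}} y$ if and only if $\phi(x)\le_{\mathbf{Q}}\phi(y)$. $\mathbf{V}_{1,1}$ is the three-element poset $\{x,y,z\}$ with $x<y$, $x<z$, and $y,z$ incomparable. For posets $\mathbf{P}_1,\dots,\mathbf{P}_k$, $R(\mathbf{P}_1,\dots,\mathbf{P}_k)$ is the minimum $N$ such that for every coloring $c:2^{[N]}\to[k]$, there is some $i$ such that $\mathbf{B}_N$ contains a subposet isomorphic to $\mathbf{P}_i$ all of whose elements have color $i$; it is known that $R(\mathbf{V}_{1,1},\dots,\mathbf{V}_{1,1})=k+1$ ($k$ copies). Let $n=R(\mathbf{P}_1,\dots,\mathbf{P}_k)$. A subposet $\mathbf{Q}\subseteq\mathbf{B}_n$ (with induced order) is called minimal $(\mathbf{P}_1,\dots,\mathbf{P}_k)$-Ramsey if every coloring of the elements of $\mathbf{Q}$ with colors $[k]$ yields, for some $i$, a subposet of $\mathbf{Q}$ isomorphic to $\mathbf{P}_i$ with all elements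 of color $i$, but for every subposet $\mathbf{Q}'\subset\mathbf{Q}$ with $|\mathbf{Q}'|=|\mathbf{Q}|-1$ there is a $k$-coloring of $\mathbf{Q}'$ with no such monochromatic $\mathbf{P}_i$ of color $i$ for any $i$. When all $\mathbf{P}_i=\mathbf{P}$, this is called minimal $(\mathbf{P};k)$-Ramsey. *)

theory Defs
  imports Main "HOL-Library.FuncSet"
begin

(* A poset is represented by its reflexive order relation r, with ground set Field r.
   A subposet of a Boolean lattice is represented by its ground set, a family of sets,
   and carries the induced inclusion order. *)

definition inclusion_order :: "'a set set \<Rightarrow> 'a set rel" where
  "inclusion_order F = relation_of (\<subseteq>) F"

definition boolean_lattice :: "nat \<Rightarrow> nat set rel" where
  "boolean_lattice N = inclusion_order (Pow {1..N})"

definition subposet_embedding :: "'p rel \<Rightarrow> 'q rel \<Rightarrow> ('p \<Rightarrow> 'q) \<Rightarrow> bool" where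
  "subposet_embedding P Q \<phi> \<longleftrightarrow>
     \<phi> \<in> Field P \<rightarrow> Field Q \<and> inj_on \<phi> (Field P) \<and>
     (\<forall>x \<in> Field P. \<forall>y \<in> Field P. (x, y) \<in> P \<longleftrightarrow> (\<phi> x, \<phi> y) \<in> Q)"

(* The poset on {0, 1, 2} with 0 < 1, 0 < 2, and 1, 2 incomparable. *)
definition V11 :: "nat rel" where
  "V11 = {(0, 0), (1, 1), (2, 2), (0, 1), (0, 2)}"

definition has_monochromatic :: "'p rel \<Rightarrow> 'q rel \<Rightarrow> ('q \<Rightarrow> nat) \<Rightarrow> nat \<Rightarrow> bool" where
  "has_monochromatic P Q c i \<longleftrightarrow>
     (\<exists>\<phi>. subposet_embedding P Q \<phi> \<and> (\<forall>x \<in> Field P. c (\<phi> x) = i))"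

(* Only P 1, ..., P k are relevant. *)
definition ramsey_poset :: "nat \<Rightarrow> (nat \<Rightarrow> 'p rel) \<Rightarrow> 'q rel \<Rightarrow> bool" where
  "ramsey_poset k P Q \<longleftrightarrow>
     (\<forall>c \<in> Field Q \<rightarrow> {1..k}. \<exists>i \<in> {1..k}. has_monochromatic (P i) Q c i)"

definition ramsey_number :: "nat \<Rightarrow> (nat \<Rightarrow> 'p rel) \<Rightarrow> nat" where
  "ramsey_number k P = (LEAST N. ramsey_poset k P (boolean_lattice N))"

definition minimal_ramsey :: "nat \<Rightarrow> (nat \<Rightarrow> 'p rel) \<Rightarrow> nat set set \<Rightarrow> bool" where
  "minimal_ramsey k P Q \<longleftrightarrow>
     Q \<subseteq> Pow {1..ramsey_number k P} \<and>
     ramsey_poset k P (inclusion_order Q) \<and>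
     (\<forall>Q'. Q' \<subset> Q \<and> card Q' = card Q - 1 \<longrightarrow> \<not> ramsey_poset k P (inclusion_order Q'))"

end

theory Submission
  imports Defs
begin

text \<open>
  Write \<open>n = k + 1\<close>. That \<open>k\<close> colors force a monochromatic V in the proper subsets of \<open>[n]\<close> is shown
  by climbing: if there is no V at \<open>T\<close>, then the proper subsets above \<open>T\<close> that share its color form
  a chain, so some element \<open>x\<close> lies in none of them, and in the interval above \<open>T \<union> {x}\<close> one color
  has been lost along with one dimension.

  Conversely, no \<open>A \<noteq> [n]\<close> can be spared. Start from coloring by cardinality, and shift the proper
  supersets of \<open>A\<close> down by one level. A set \<open>X\<close> not containing \<open>A\<close> then has at most one set of its
  own color above it, namely \<open>X \<union> A\<close>. The coatoms not containing \<open>A\<close> would need an additional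
  color; there are \<open>|A|\<close> of them, and they are distributed injectively over the \<open>|A|\<close> lowest
  colors, none of which is used by a superset of \<open>A\<close> other than \<open>[n]\<close>.
\<close>

section \<open>Monochromatic V's in families of sets\<close>

text \<open>The common color is read off at the bottom as \<open>c X\<close>, so no color index is
  needed and the color type stays arbitrary.\<close>

definition mono_V :: "'a set set \<Rightarrow> ('a set \<Rightarrow> 'b) \<Rightarrow> bool" where
  "mono_V Q c \<longleftrightarrow>
     (\<exists>X\<in>Q. \<exists>Y\<in>Q. \<exists>Z\<in>Q. X \<subset> Y \<and> X \<subset> Z \<and> \<not> Y \<subseteq> Z \<and> \<not> Z \<subseteq> Y \<and> c Y = c X \<and> c Z = c X)"

lemma Field_inclusion_order [simp]: "Field (inclusion_order F) = F"
  by (auto simp: inclusion_order_def relation_of_def Field_def)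

lemma inclusion_order_iff [simp]: "(X, Y) \<in> inclusion_order F \<longleftrightarrow> X \<in> F \<and> Y \<in> F \<and> X \<subseteq> Y"
  by (auto simp: inclusion_order_def relation_of_def)

lemma Field_V11 [simp]: "Field V11 = {0, 1, 2}"
  by (auto simp: V11_def Field_def)

lemma has_monochromatic_V11_iff:
  "has_monochromatic V11 (inclusion_order Q) c i \<longleftrightarrow>
     (\<exists>X\<in>Q. \<exists>Y\<in>Q. \<exists>Z\<in>Q. X \<subset> Y \<and> X \<subset> Z \<and> \<not> Y \<subseteq> Z \<and> \<not> Z \<subseteq> Y \<and> c X = i \<and> c Y = i \<and> c Z = i)"
  (is "?L \<longleftrightarrow> ?R")
proof
  assume ?L
  then obtain f where f: "subposet_embedding V11 (inclusion_order Q) f"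
    and c: "\<forall>x\<in>{0, 1, 2}. c (f x) = i"
    by (auto simp: has_monochromatic_def)
  have Q: "f 0 \<in> Q" "f 1 \<in> Q" "f 2 \<in> Q"
    using f by (auto simp: subposet_embedding_def)
  have order: "(x, y) \<in> V11 \<longleftrightarrow> f x \<subseteq> f y" if "x \<in> {0, 1, 2}" "y \<in> {0, 1, 2}" for x y
    using f that unfolding subposet_embedding_def Field_V11 Field_inclusion_order
    by (metis PiE inclusion_order_iff)
  have "f 0 \<subset> f 1" "f 0 \<subset> f 2" "\<not> f 1 \<subseteq> f 2" "\<not> f 2 \<subseteq> f 1"
    using order[of 0 1] order[of 1 0] order[of 0 2] order[of 2 0] order[of 1 2] order[of 2 1]
    by (auto simp: V11_def)
  with Q c show ?R by blast
next
  assume ?R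
  then obtain X Y Z where XYZ: "X \<in> Q" "Y \<in> Q" "Z \<in> Q" "X \<subset> Y" "X \<subset> Z" "\<not> Y \<subseteq> Z" "\<not> Z \<subseteq> Y"
    "c X = i" "c Y = i" "c Z = i"
    by blast
  define f :: "nat \<Rightarrow> 'a set" where "f = (\<lambda>j. if j = 0 then X else if j = 1 then Y else Z)"
  have "subposet_embedding V11 (inclusion_order Q) f"
    using XYZ by (auto simp: subposet_embedding_def f_def inj_on_def V11_def)
  moreover have "\<forall>x\<in>Field V11. c (f x) = i"
    using XYZ by (auto simp: f_def)
  ultimately show ?L
    unfolding has_monochromatic_def by blast
qed

lemma ramsey_V11_iff:
  "ramsey_poset k (\<lambda>_. V11) (inclusion_order Q) \<longleftrightarrow> (\<forall>c \<in> Q \<rightarrow> {1..k}. mono_V Q c)"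
proof -
  have "(\<exists>i\<in>{1..k}. has_monochromatic V11 (inclusion_order Q) c i) \<longleftrightarrow> mono_V Q c"
    if "c \<in> Q \<rightarrow> {1..k}" for c
  proof
    assume "mono_V Q c"
    then obtain X where "X \<in> Q" "has_monochromatic V11 (inclusion_order Q) c (c X)"
      unfolding mono_V_def has_monochromatic_V11_iff by metis
    with that show "\<exists>i\<in>{1..k}. has_monochromatic V11 (inclusion_order Q) c i"
      by (metis PiE)
  next
    assume "\<exists>i\<in>{1..k}. has_monochromatic V11 (inclusion_order Q) c i"
    then show "mono_V Q c"
      unfolding mono_V_def has_monochromatic_V11_iff by metis
  qed
  then show ?thesis
    by (auto simp: ramsey_poset_def)
qed

text \<open>A coloring of \<open>Q'\<close> also colors \<open>Q\<close>, and a V found there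
  survives. Hence non-Ramsey claims reduce to families omitting a single set.\<close>

lemma ramsey_V11_mono:
  assumes "ramsey_poset k (\<lambda>_. V11) (inclusion_order Q)" and "Q \<subseteq> Q'"
  shows "ramsey_poset k (\<lambda>_. V11) (inclusion_order Q')"
  unfolding ramsey_V11_iff
proof
  fix c assume "c \<in> Q' \<rightarrow> {1..k}"
  with assms(2) have "c \<in> Q \<rightarrow> {1..k}" by blast
  with assms(1) have "mono_V Q c" by (simp add: ramsey_V11_iff)
  with assms(2) show "mono_V Q' c" unfolding mono_V_def by (meson subsetD)
qed

section \<open>Forcing a V by climbing\<close>

lemma finite_chain_Union_mem:
  assumes "finite M" "M \<noteq> {}" "\<And>Y Z. Y \<in> M \<Longrightarrow> Z \<in> M \<Longrightarrow> Y \<subseteq> Z \<or> Z \<subseteq> Y"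
  shows "\<Union>M \<in> M"
proof -
  obtain W where "W \<in> M" and max: "\<And>S. S \<in> M \<Longrightarrow> W \<subseteq> S \<Longrightarrow> W = S"
    using finite_has_maximal[OF assms(1,2)] by metis
  have "\<Union>M = W"
    using assms(3)[OF _ \<open>W \<in> M\<close>] max \<open>W \<in> M\<close> by blast
  with \<open>W \<in> M\<close> show ?thesis by simp
qed

text \<open>The induction moves the bottom \<open>T\<close> and shrinks the color set
  \<open>C\<close>, so both are arbitrary; the conclusion mentions neither and passes unchanged to
  the next interval.\<close>

lemma mono_V_interval:
  assumes "finite U" "T \<subseteq> U" "finite C" "card C < card (U - T)"
    and "\<And>S. T \<subseteq> S \<Longrightarrow> S \<subset> U \<Longrightarrow> c S \<in> C"
  shows "mono_V {S. S \<subset> U} c"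
  using assms
proof (induction "card C" arbitrary: C T rule: less_induct)
  case less
  have "T \<subset> U"
    using less.prems(2,4) by auto
  \<comment> \<open>In particular \<open>C\<close> is nonempty, so no separate base case
    arises.\<close>
  then have cT: "c T \<in> C"
    using less.prems(5) by blast
  define M where "M = {S. T \<subset> S \<and> S \<subset> U \<and> c S = c T}"
  show ?case
  proof (cases "\<forall>Y\<in>M. \<forall>Z\<in>M. Y \<subseteq> Z \<or> Z \<subseteq> Y")
    case False
    then obtain Y Z where "Y \<in> M" "Z \<in> M" "\<not> Y \<subseteq> Z" "\<not> Z \<subseteq> Y" by blast
    then show ?thesis
      unfolding mono_V_def M_def using \<open>T \<subset> U\<close> by blast
  next
    case True
    have "finite M"
      by (rule finite_subset[of _ "Pow U"]) (auto simp: M_def \<open>finite U\<close>)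
    \<comment> \<open>If the chain \<open>M\<close> is nonempty, its union is its largest member,
      hence still a proper subset of \<open>U\<close>.\<close>
    have "\<exists>x\<in>U - T. \<forall>S\<in>M. x \<notin> S"
    proof (cases "M = {}")
      case True
      with \<open>T \<subset> U\<close> show ?thesis by blast
    next
      case False
      with \<open>finite M\<close> True have "\<Union>M \<in> M" by (intro finite_chain_Union_mem) auto
      then have "\<Union>M \<subset> U" "T \<subset> \<Union>M" by (simp_all add: M_def)
      then show ?thesis by blast
    qed
    then obtain x where x: "x \<in> U" "x \<notin> T" "\<forall>S\<in>M. x \<notin> S" by blast
    have smaller: "card (C - {c T}) < card C"
      using cT \<open>finite C\<close> by (rule card_Diff1_less[rotated])
    have "U - insert x T = (U - T) - {x}" by blast
    then have "card (U - insert x T) = card (U - T) - 1"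
      using x by simp
    moreover have "card (C - {c T}) = card C - 1"
      using cT by simp
    ultimately have "card (C - {c T}) < card (U - insert x T)"
      using less.prems(4) smaller by linarith
    moreover have "insert x T \<subseteq> U" "finite (C - {c T})"
      using x \<open>T \<subset> U\<close> \<open>finite C\<close> by auto
    \<comment> \<open>Such an \<open>S\<close> contains \<open>x\<close>, so it is outside
      \<open>M\<close> although it lies properly between \<open>T\<close> and \<open>U\<close>; its
      color cannot be \<open>c T\<close>.\<close>
    moreover have "c S \<in> C - {c T}" if "insert x T \<subseteq> S" "S \<subset> U" for S
      using that x less.prems(5)[of S] by (auto simp: M_def)
    ultimately show ?thesis
      using less.hyps[OF smaller \<open>finite U\<close>] by metis
  qed
qed

lemma ramsey_proper_subsets:
  "ramsey_poset k (\<lambda>_. V11) (inclusion_order {S. S \<subset> {1..k + 1}})"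
  unfolding ramsey_V11_iff
proof
  fix c :: "nat set \<Rightarrow> nat"
  assume "c \<in> {S. S \<subset> {1..k + 1}} \<rightarrow> {1..k}"
  then show "mono_V {S. S \<subset> {1..k + 1}} c"
    by (intro mono_V_interval[where T = "{}" and C = "{1..k}"]) auto
qed

section \<open>A good coloring after removing one set\<close>

lemma not_ramsey_remove:
  assumes "k \<ge> 1" and A: "A \<subset> {1..k + 1}"
  shows "\<not> ramsey_poset k (\<lambda>_. V11) (inclusion_order (Pow {1..k + 1} - {A}))"
proof -
  define U where "U = {1..k + 1}"
  have U: "finite U" "card U = k + 1" by (simp_all add: U_def)
  have "A \<subset> U" using A by (simp add: U_def)
  then have "finite A" using U(1) finite_subset by blast
  have "card A \<le> k"
    using psubset_card_mono[OF U(1) \<open>A \<subset> U\<close>] U(2) by simp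
  \<comment> \<open>A coatom not containing \<open>A\<close> is \<open>U - {x}\<close> with
    \<open>x \<in> A\<close>, and \<open>g x\<close> will be its color.\<close>
  have "\<exists>g. bij_betw g A {1..card A}"
    using \<open>finite A\<close> by (subst bij_betw_iff_card) auto
  then obtain g where g: "bij_betw g A {1..card A}" by blast
  \<comment> \<open>Off the supersets of \<open>A\<close>, the value \<open>card S + 1\<close>
    leaves the range only at coatoms, where \<open>g\<close> replaces it. The top is comparable to
    every set and has none above it, so it lies in no V and may get any color.\<close>
  define c where "c S = (if S = U then k else if A \<subseteq> S then card S
      else if card S = k then g (the_elem (U - S)) else card S + 1)" for S
  have less: "card S \<le> k" if "S \<subset> U" for S
    using psubset_card_mono[OF U(1) that] U(2) by simp
  have coatom: "the_elem (U - S) \<in> A \<and> S = U - {the_elem (U - S)}"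
    if "S \<subset> U" "\<not> A \<subseteq> S" "card S = k" for S
  proof -
    have "card (U - S) = 1"
      using that U finite_subset[of S U] by (simp add: card_Diff_subset psubset_imp_subset)
    then obtain x where x: "U - S = {x}" by (auto simp: card_1_singleton_iff)
    with that \<open>A \<subset> U\<close> show ?thesis by auto
  qed
  have range_g: "1 \<le> g x \<and> g x \<le> card A" if "x \<in> A" for x
    using g that by (force simp: bij_betw_def)
  have "c \<in> Pow U - {A} \<rightarrow> {1..k}"
  proof
    fix S assume S: "S \<in> Pow U - {A}"
    then have "finite S" using U(1) finite_subset by auto
    show "c S \<in> {1..k}"
    proof (cases "S = U")
      case False
      then have "S \<subset> U" using S by blast
      show ?thesis
      proof (cases "A \<subseteq> S")
        case True
        \<comment> \<open>An empty superset of \<open>A\<close> would be \<open>A\<close> itself,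
          which is removed; so the value 0 never occurs.\<close>
        then have "S \<noteq> {}" using S by blast
        then have "0 < card S" using \<open>finite S\<close> by (simp add: card_gt_0_iff)
        then show ?thesis
          using True \<open>S \<noteq> U\<close> less[OF \<open>S \<subset> U\<close>] by (simp add: c_def)
      next
        case False
        show ?thesis
        proof (cases "card S = k")
          case True
          then have "1 \<le> g (the_elem (U - S)) \<and> g (the_elem (U - S)) \<le> card A"
            using coatom[OF \<open>S \<subset> U\<close> False] range_g by blast
          with True False \<open>S \<noteq> U\<close> \<open>card A \<le> k\<close> show ?thesis by (simp add: c_def)
        next
          assume "card S \<noteq> k"
          with False \<open>S \<noteq> U\<close> less[OF \<open>S \<subset> U\<close>] show ?thesis by (simp add: c_def)
        qed
      qed
    qed (use assms in \<open>simp add: c_def\<close>)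
  qed
  moreover have "\<not> mono_V (Pow U - {A}) c"
  proof
    assume "mono_V (Pow U - {A}) c"
    then obtain X Y Z where XYZ: "X \<subset> Y" "X \<subset> Z" "\<not> Y \<subseteq> Z" "\<not> Z \<subseteq> Y" "Y \<subseteq> U" "Z \<subseteq> U"
      and neq: "X \<noteq> A" "Y \<noteq> A" "Z \<noteq> A" and eq: "c Y = c X" "c Z = c X"
      unfolding mono_V_def by auto
    have sub: "X \<subset> U" "Y \<subset> U" "Z \<subset> U" using XYZ by auto
    then have "X \<noteq> U" "Y \<noteq> U" by auto
    have fin: "finite X" "finite Y" "finite Z" using sub U(1) finite_subset by auto
    have card: "card X < card Y" "card X < card Z"
      using XYZ(1,2) fin by (simp_all add: psubset_card_mono)
    have X: "card X < k"
      using card less[OF sub(2)] by simp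
    \<comment> \<open>Above \<open>A\<close> and below the top, colors are cardinalities and
      increase strictly along inclusion.\<close>
    have nX: "\<not> A \<subseteq> X"
    proof
      assume "A \<subseteq> X"
      moreover then have "A \<subseteq> Y" using XYZ by blast
      ultimately show False
        using eq(1) card(1) \<open>A \<subseteq> X\<close> \<open>X \<noteq> U\<close> \<open>Y \<noteq> U\<close> by (simp add: c_def)
    qed
    then have cX: "c X = card X + 1"
      using X \<open>X \<noteq> U\<close> by (simp add: c_def)
    \<comment> \<open>The two shapes exclude each other: values of \<open>g\<close> are at most
      \<open>card A\<close>, while a proper superset of \<open>A\<close> has a larger color.\<close>
    have above: "(A \<subseteq> S \<and> S = X \<union> A \<and> card A < c X) \<or>
        (S = U - {the_elem (U - S)} \<and> the_elem (U - S) \<in> A \<and> g (the_elem (U - S)) = c X)"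
      if S: "X \<subset> S" "S \<subset> U" "S \<noteq> A" "c S = c X" for S
    proof -
      have "finite S" "S \<noteq> U" using S U(1) finite_subset by auto
      then have "card X < card S" using S by (simp add: psubset_card_mono)
      show ?thesis
      proof (cases "A \<subseteq> S")
        case True
        then have "card S = card X + 1" using \<open>S \<noteq> U\<close> S(4) cX by (simp add: c_def)
        moreover have "card X < card (X \<union> A)"
          using nX fin \<open>finite A\<close> by (intro psubset_card_mono) auto
        ultimately have "X \<union> A = S"
          using True S(1) \<open>finite S\<close> by (intro card_seteq) auto
        moreover have "card A < card S"
          using True S \<open>finite S\<close> by (intro psubset_card_mono) auto
        ultimately show ?thesis
          using True \<open>card S = card X + 1\<close> cX by simp
      next
        case False
        then have "card S = k"
          using \<open>S \<noteq> U\<close> S(4) cX \<open>card X < card S\<close> by (auto simp: c_def split: if_splits)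
        then show ?thesis
          using coatom[OF S(2) False] S(4) \<open>S \<noteq> U\<close> False by (simp add: c_def)
      qed
    qed
    \<comment> \<open>Two coatoms coincide by injectivity of \<open>g\<close>, two copies of
      \<open>X \<union> A\<close> trivially; mixed shapes clash in color.\<close>
    have "Y = Z"
      using above[OF XYZ(1) sub(2) neq(2) eq(1)] above[OF XYZ(2) sub(3) neq(3) eq(2)]
    proof (elim disjE conjE)
      assume *: "Y = U - {the_elem (U - Y)}" "the_elem (U - Y) \<in> A" "g (the_elem (U - Y)) = c X"
        "Z = U - {the_elem (U - Z)}" "the_elem (U - Z) \<in> A" "g (the_elem (U - Z)) = c X"
      then have "the_elem (U - Y) = the_elem (U - Z)"
        using g by (metis bij_betw_imp_inj_on inj_onD)
      with *(1,4) show ?thesis by simp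
    next
      assume "card A < c X" "the_elem (U - Z) \<in> A" "g (the_elem (U - Z)) = c X"
      then show ?thesis using range_g by (metis not_le)
    next
      assume "card A < c X" "the_elem (U - Y) \<in> A" "g (the_elem (U - Y)) = c X"
      then show ?thesis using range_g by (metis not_le)
    qed simp
    with XYZ show False by simp
  qed
  ultimately show ?thesis
    unfolding ramsey_V11_iff U_def by blast
qed

section \<open>The Ramsey number and uniqueness\<close>

lemma ramsey_number_V11:
  assumes "k \<ge> 1"
  shows "ramsey_number k (\<lambda>_. V11) = k + 1"
  unfolding ramsey_number_def
proof (rule Least_equality)
  show "ramsey_poset k (\<lambda>_. V11) (boolean_lattice (k + 1))"
    unfolding boolean_lattice_def
    by (rule ramsey_V11_mono[OF ramsey_proper_subsets]) auto
next
  fix N assume N: "ramsey_poset k (\<lambda>_. V11) (boolean_lattice N)"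
  show "k + 1 \<le> N"
  proof (rule ccontr)
    assume "\<not> k + 1 \<le> N"
    \<comment> \<open>The singleton \<open>{k + 1}\<close> is missing from every smaller lattice,
      and \<open>k \<ge> 1\<close> keeps it different from the top.\<close>
    then have "Pow {1..N} \<subseteq> Pow {1..k + 1} - {{k + 1}}" by auto
    with N have "ramsey_poset k (\<lambda>_. V11) (inclusion_order (Pow {1..k + 1} - {{k + 1}}))"
      unfolding boolean_lattice_def by (rule ramsey_V11_mono)
    moreover have "{k + 1} \<subseteq> {1..k + 1}" "1 \<in> {1..k + 1}" "1 \<notin> {k + 1}"
      using assms by simp_all
    then have "{k + 1} \<subset> {1..k + 1}" by blast
    ultimately show False
      using not_ramsey_remove[OF assms] by blast
  qed
qed

theorem theorem3:
  fixes k :: nat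
  assumes "k \<ge> 1"
  shows "minimal_ramsey k (\<lambda>_. V11) (Pow {1..k + 1} - {{1..k + 1}}) \<and>
         (\<forall>Q. minimal_ramsey k (\<lambda>_. V11) Q \<longrightarrow> Q = Pow {1..k + 1} - {{1..k + 1}})"
proof -
  define P where "P = Pow {1..k + 1} - {{1..k + 1}}"
  have "P = {S. S \<subset> {1..k + 1}}" by (auto simp: P_def)
  then have ramsey_P: "ramsey_poset k (\<lambda>_. V11) (inclusion_order P)"
    using ramsey_proper_subsets by simp
  \<comment> \<open>\<open>P\<close> is thus the least Ramsey family in the lattice, which yields
    both minimality and uniqueness.\<close>
  have contains: "P \<subseteq> Q"
    if "Q \<subseteq> Pow {1..k + 1}" "ramsey_poset k (\<lambda>_. V11) (inclusion_order Q)" for Q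
  proof
    fix A assume "A \<in> P"
    then have "A \<subset> {1..k + 1}" by (auto simp: P_def)
    show "A \<in> Q"
    proof (rule ccontr)
      assume "A \<notin> Q"
      with that(1) have "Q \<subseteq> Pow {1..k + 1} - {A}" by blast
      with that(2) have "ramsey_poset k (\<lambda>_. V11) (inclusion_order (Pow {1..k + 1} - {A}))"
        by (rule ramsey_V11_mono)
      with not_ramsey_remove[OF assms \<open>A \<subset> {1..k + 1}\<close>] show False by blast
    qed
  qed
  have "P \<subseteq> Pow {1..k + 1}" by (auto simp: P_def)
  then have "minimal_ramsey k (\<lambda>_. V11) P"
    unfolding minimal_ramsey_def ramsey_number_V11[OF assms]
    using ramsey_P contains by blast
  moreover have "Q = P" if "minimal_ramsey k (\<lambda>_. V11) Q" for Q
  proof (rule ccontr)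
    assume "Q \<noteq> P"
    have Q: "Q \<subseteq> Pow {1..k + 1}" "ramsey_poset k (\<lambda>_. V11) (inclusion_order Q)"
      using that by (simp_all add: minimal_ramsey_def ramsey_number_V11[OF assms])
    with \<open>Q \<noteq> P\<close> contains have "P \<subset> Q" by blast
    \<comment> \<open>Only the top can be extra in \<open>Q\<close>, and deleting it leaves the
      Ramsey family \<open>P\<close>, against minimality of \<open>Q\<close>.\<close>
    with Q(1) have "P = Q - {{1..k + 1}}" "{1..k + 1} \<in> Q" by (auto simp: P_def)
    then have "card P = card Q - 1" by simp
    with that \<open>P \<subset> Q\<close> ramsey_P show False
      unfolding minimal_ramsey_def by blast
  qed
  ultimately show ?thesis
    unfolding P_def by blast
qed

end
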